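(* For every real $x>1$, \[ \sum_{1\le d\leq x} g(d) = c_1x^{3/2} - 2x - 2\sqrt{x} + \theta\,(x+4\sqrt{x}) \] for some $\theta=\theta(x)\in[0,1]$, where $c_1 := \frac{4}{3}\log 2$; and \[ \sum_{1\le d\leq x} g(d)^2 \leq 11.9\,x^2 + 5\,x^{3/2}\log^2(4e^4x). \] The sums run over integers $d$.
   Context: For a positive integer $d$, let $g(d)$ be the number of pairs $(m,q)$ of nonnegative integers such that $m<\sqrt{d}$, $|q-\sqrt{d}|<m$, and $q$ divides $d-m^2$. *)

theory Defs
  imports "HOL-Analysis.Analysis"
begin

text \<open>The divisibility is stated over the integers, so that \<open>d - m\<^sup>2\<close> is not truncated.\<close>

definition g :: "nat \<Rightarrow> nat" where
  "g d = card {(m :: nat, q :: nat).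
     real m < sqrt (real d) \<and> \<bar>real q - sqrt (real d)\<bar> < real m \<and>
     int q dvd int d - (int m)\<^sup>2}"

definition c\<^sub>1 :: real where
  "c\<^sub>1 = 4 / 3 * ln 2"

end

theory Submission
  imports Defs
begin

text \<open>
  Writing \<open>d = m\<^sup>2 + q r\<close>, the conditions on \<open>(m, q)\<close> become \<open>\<bar>q - r\<bar> < 2 m\<close>, which is symmetric in \<open>q\<close>
  and \<open>r\<close>.

  First moment: let \<open>K = \<lfloor>\<surd>x\<rfloor>\<close>. For fixed \<open>m\<close>, counting \<open>r\<close> and summing over \<open>q\<close> gives
  \<open>(K - m)(2 m - 1)\<close> plus the sum of \<open>\<lfloor>(x - m\<^sup>2) / q\<rfloor>\<close> over the \<open>2 m\<close> values \<open>K - m < q \<le> K + m\<close>.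
  Removing the floors costs at most \<open>K (K + 1)\<close> in total, and the remaining double sum has a closed form in terms
  of \<open>H\<^bsub>2K\<^esub> - H\<^bsub>K\<^esub>\<close>, which is \<open>ln 2 - 1 / (4 K)\<close> up to \<open>O(1 / K\<^sup>2)\<close>.

  Second moment: by symmetry it suffices to count pairs with \<open>q \<le> r\<close>, at the cost of a factor 4. Two
  pairs \<open>(q, m)\<close> and \<open>(q', m')\<close> occur together only for \<open>d\<close> in one class modulo \<open>lcm q q'\<close>, and only if
  \<open>e = gcd q q'\<close> divides \<open>m\<^sup>2 - m'\<^sup>2\<close>. For fixed \<open>d\<close> and \<open>q \<le> r\<close> the admissible \<open>m\<close> lie in a
  block of exactly \<open>q\<close> consecutive integers, hence cover all classes modulo \<open>e\<close> equally often. As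
  \<open>x\<^sup>2 \<equiv> y\<^sup>2\<close> has at most \<open>2 e \<tau>(e)\<close> solutions modulo \<open>e\<close>, everything reduces to the sum of
  \<open>\<tau>(gcd q q')\<close> over \<open>q, q' \<le> \<surd>d\<close>, which is at most \<open>\<zeta>(2) d\<close>.
\<close>

section \<open>Representations by triples\<close>

text \<open>\<open>r\<close> is the cofactor of \<open>q\<close> in d - m^2. The bound |q - r| < 2m
  is split into two inequalities because subtraction of naturals truncates.\<close>

definition triples :: "nat \<Rightarrow> (nat \<times> nat \<times> nat) set" where
  "triples d = {(m, q, r). 0 < q \<and> 0 < r \<and> q < r + 2 * m \<and> r < q + 2 * m \<and> d = m\<^sup>2 + q * r}"

text \<open>Once d = m^2 + q r, squaring turns sqrt d < q + m into r < q + 2m, and q - m < sqrt d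
  into q < r + 2m, after a factor q is cancelled.\<close>

lemma g_pair_iff_triple:
  "real m < sqrt (real d) \<and> \<bar>real q - sqrt (real d)\<bar> < real m \<and> int q dvd int d - (int m)\<^sup>2
     \<longleftrightarrow> (\<exists>r. (m, q, r) \<in> triples d)" (is "?L \<longleftrightarrow> ?R")
proof
  assume L: ?L
  \<comment> \<open>For q = 0 the second condition would give sqrt d < m, against the first.\<close>
  have q0: "0 < q" using L by (cases "q = 0") auto
  have "(real m)\<^sup>2 < (sqrt d)\<^sup>2" using L by (intro power_strict_mono) auto
  then have md: "m\<^sup>2 < d" by (metis of_nat_0_le_iff of_nat_less_iff of_nat_power real_sqrt_pow2)
  have "int q dvd int (d - m\<^sup>2)" using L md by (simp add: of_nat_diff)
  then obtain r where "d - m\<^sup>2 = q * r" by (metis dvdE of_nat_dvd_iff)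
  then have d: "d = m\<^sup>2 + q * r" using md by simp
  have r0: "0 < r" using d md by (cases r) auto
  have "(sqrt d)\<^sup>2 < (real q + real m)\<^sup>2" using L by (intro power_strict_mono) auto
  then have "real d < real ((q + m)\<^sup>2)" by simp
  then have "d < (q + m)\<^sup>2" by linarith
  then have "q * r < q * (q + 2 * m)" unfolding d by (simp add: power2_eq_square algebra_simps)
  then have r: "r < q + 2 * m" by simp
  \<comment> \<open>Squaring needs a nonnegative q - m; for q \<le> m the claim is
    immediate.\<close>
  have "q < r + 2 * m"
  proof (cases "q \<le> m")
    case True then show ?thesis using r0 by linarith
  next
    case False
    then have "(real q - real m)\<^sup>2 < (sqrt d)\<^sup>2" using L by (intro power_strict_mono) auto
    then have "(real q - real m)\<^sup>2 < real d" by simp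
    then have "real q * real q < real q * (real r + 2 * real m)"
      unfolding d by (simp add: power2_eq_square algebra_simps)
    then have "real q < real r + 2 * real m" using q0 by simp
    then show ?thesis by linarith
  qed
  then show ?R using q0 r0 r d by (auto simp: triples_def)
next
  assume ?R
  then obtain r where q0: "0 < q" and r0: "0 < r" and qr: "q < r + 2 * m" and rq: "r < q + 2 * m"
    and d: "d = m\<^sup>2 + q * r" by (auto simp: triples_def)
  have "m\<^sup>2 < d" using d q0 r0 by simp
  then have 1: "real m < sqrt d" by (intro real_less_rsqrt) (metis of_nat_less_iff of_nat_power)
  have "q * r < q * (q + 2 * m)" using q0 rq by simp
  then have "d < (q + m)\<^sup>2" unfolding d by (simp add: power2_eq_square algebra_simps)
  then have "real d < (real (q + m))\<^sup>2" by (metis of_nat_less_iff of_nat_power)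
  then have 2: "sqrt d < real q + real m" by (intro real_less_lsqrt) auto
  have "real q * real q < real q * (real r + 2 * real m)" using q0 qr by simp
  then have "(real q - real m)\<^sup>2 < real d" unfolding d by (simp add: power2_eq_square algebra_simps)
  then have 3: "real q - real m < sqrt d" by (rule real_less_rsqrt)
  have "int q dvd int d - (int m)\<^sup>2" unfolding d by simp
  with 1 2 3 show ?L by auto
qed

lemma g_eq_card_triples: "g d = card (triples d)"
proof -
  have "{(m, q). real m < sqrt (real d) \<and> \<bar>real q - sqrt (real d)\<bar> < real m \<and> int q dvd int d - (int m)\<^sup>2}
      = (\<lambda>(m, q, r). (m, q)) ` triples d"
    unfolding g_pair_iff_triple by force
  moreover have "inj_on (\<lambda>(m, q, r). (m, q)) (triples d)"
    by (rule inj_onI) (auto simp: triples_def)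
  ultimately show ?thesis unfolding g_def by (simp add: card_image)
qed

section \<open>The first moment\<close>

lemma harm_double_diff_Suc:
  "harm (2 * Suc k) - harm (Suc k) = (harm (2 * k) - harm k :: real) + 1 / (2 * k + 1) - 1 / (2 * k + 2)"
proof -
  have "harm (2 * Suc k) = (harm (2 * k) :: real) + 1 / (2 * real k + 1) + 1 / (2 * real k + 2)"
    by (simp add: harm_Suc inverse_eq_divide add.commute)
  moreover have "harm (Suc k) = (harm k :: real) + 1 / (2 * real k + 2) + 1 / (2 * real k + 2)"
    by (simp add: harm_Suc divide_simps) (simp add: algebra_simps)
  ultimately show ?thesis by linarith
qed

text \<open>Euler's constant is the limit of \<open>harm n - ln n\<close> both along n and along 2n;
  it cancels, and ln (2n) - ln n = ln 2 remains.\<close>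

lemma harm_double_diff_tendsto: "(\<lambda>n. harm (2 * n) - harm n :: real) \<longlonglongrightarrow> ln 2"
proof -
  have "(\<lambda>n. harm n - ln (real n) :: real) \<longlonglongrightarrow> euler_mascheroni"
    by (rule euler_mascheroni_LIMSEQ)
  moreover from this have "(\<lambda>n. harm (2 * n) - ln (real (2 * n)) :: real) \<longlonglongrightarrow> euler_mascheroni"
    by (rule filterlim_compose) (auto intro!: mult_nat_left_at_top)
  ultimately have "(\<lambda>n. (harm (2 * n) - ln (real (2 * n))) - (harm n - ln (real n)) + ln 2 :: real)
      \<longlonglongrightarrow> euler_mascheroni - euler_mascheroni + ln 2" by (intro tendsto_intros)
  then have "(\<lambda>n. (harm (2 * n) - ln (real (2 * n))) - (harm n - ln (real n)) + ln 2 :: real) \<longlonglongrightarrow> ln 2"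
    by simp
  moreover have "\<forall>\<^sub>F n in sequentially. (harm (2 * n) - ln (real (2 * n))) - (harm n - ln (real n)) + ln 2
      = (harm (2 * n) - harm n :: real)"
    using eventually_gt_at_top[of 0] by eventually_elim (simp add: ln_mult)
  ultimately show ?thesis by (rule Lim_transform_eventually)
qed

text \<open>Adding 1/(4k) makes the sequence decrease to its limit ln 2, so each term is at least ln
  2.\<close>

lemma harm_double_diff_lower:
  assumes "k > 0"
  shows "harm (2 * k) - harm k \<ge> ln 2 - 1 / (4 * real k)"
proof -
  \<comment> \<open>The index is shifted by one so that no term divides by zero; k is reached as
    \<open>a (k - 1)\<close>.\<close>
  define a where "a n = harm (2 * Suc n) - harm (Suc n) + 1 / (4 * real (Suc n))" for n
  have "a (Suc n) \<le> a n" for n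
  proof -
    define t where "t = real (Suc n)"
    have t: "t > 0" by (simp add: t_def)
    then have "1 / (2 * t + 1) - 1 / (2 * t + 2) + 1 / (4 * (t + 1)) - 1 / (4 * t) = - (1 / (4 * t * (t + 1) * (2 * t + 1)))"
      by (simp add: divide_simps) (simp add: algebra_simps)
    moreover have "1 / (4 * t * (t + 1) * (2 * t + 1)) \<ge> 0" using t by simp
    moreover have Suc: "real (Suc (Suc n)) = t + 1" by (simp add: t_def)
    ultimately show ?thesis
      unfolding a_def harm_double_diff_Suc[of "Suc n"] Suc t_def[symmetric] by linarith
  qed
  then have "decseq a" by (rule decseq_SucI)
  moreover have "a \<longlonglongrightarrow> ln 2 + 0" unfolding a_def
    by (intro tendsto_add LIMSEQ_Suc[OF harm_double_diff_tendsto] LIMSEQ_Suc)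
       (rule tendsto_divide_0[OF tendsto_const], intro filterlim_at_top_imp_at_infinity filterlim_tendsto_pos_mult_at_top[OF tendsto_const] filterlim_real_sequentially, simp)
  ultimately have "ln 2 \<le> a (k - 1)" using decseq_ge by fastforce
  then show ?thesis using assms by (simp add: a_def)
qed

text \<open>Subtracting the next correction 1/(16 k^2) reverses the monotonicity, so the sequence
  now stays below its limit ln 2.\<close>

lemma harm_double_diff_upper:
  assumes "k > 0"
  shows "harm (2 * k) - harm k \<le> ln 2 - 1 / (4 * real k) + 1 / (16 * (real k)\<^sup>2)"
proof -
  define a where "a n = harm (2 * Suc n) - harm (Suc n) + 1 / (4 * real (Suc n)) - 1 / (16 * (real (Suc n))\<^sup>2)" for n
  have "a (Suc n) \<ge> a n" for n
  proof -
    have "a (Suc n) - a n = 1 / (16 * (n + 1)^2 * (n + 2)^2 * (2 * n + 3))"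
      unfolding a_def harm_double_diff_Suc[of "Suc n"]
      by (simp add: divide_simps) (simp add: algebra_simps power2_eq_square)
    then show ?thesis by (smt (verit) divide_nonneg_nonneg of_nat_0_le_iff)
  qed
  then have "incseq a" by (rule incseq_SucI)
  moreover have "(\<lambda>n. 1 / (4 * real n)) \<longlonglongrightarrow> 0"
    by (rule tendsto_divide_0[OF tendsto_const], intro filterlim_at_top_imp_at_infinity filterlim_tendsto_pos_mult_at_top[OF tendsto_const] filterlim_real_sequentially, simp)
  from this tendsto_power[OF this, of 2] have "a \<longlonglongrightarrow> ln 2 + 0 - 0" unfolding a_def
    by (intro tendsto_add tendsto_diff LIMSEQ_Suc[OF harm_double_diff_tendsto] LIMSEQ_Suc)
       (auto simp: power_divide power_mult_distrib)
  ultimately have "a (k - 1) \<le> ln 2" using incseq_le by fastforce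
  then show ?thesis using assms by (simp add: a_def)
qed

text \<open>This is the sum of (x - m^2)/q over the windows K - m < q \<le> K + m, that is, the
  floor sums of the first moment without their floors. Raising K by one moves both ends of every
  window, and the change is again made of harmonic numbers, so induction on K works.\<close>

lemma harm_window_sum:
  fixes x :: real
  shows "(\<Sum>m=1..K. (x - (real m)\<^sup>2) * (harm (K + m) - harm (K - m))) =
    (2 * real K + 1) * (x - real K * (real K + 1) / 3) * (harm (2 * K) - harm K) - real K ^ 3 / 3 - (real K)\<^sup>2 / 6"
proof (induction K)
  case 0 then show ?case by simp
next
  case (Suc K)
  \<comment> \<open>\<open>y\<close> is the weight of the new index m = K + 1. For the old ones x -
    m^2 = y + (K + 1 - m)(K + 1 + m), so dividing by either factor leaves y over that factor and a
    linear term.\<close>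
  define y where "y = x - (real K + 1)\<^sup>2"
  have harm_split: "(\<Sum>m=1..K. inverse (real K + 1 + real m)) = harm (2 * K + 1) - harm (K + 1)" for K
  proof -
    have "harm (K + 1 + n) = harm (K + 1) + (\<Sum>m=1..n. inverse (real K + 1 + real m))" for n
      by (induction n) (auto simp: harm_Suc algebra_simps)
    from this[of K] show ?thesis by (simp add: mult_2)
  qed
  have harm_rev: "(\<Sum>m=1..K. inverse (real K + 1 - real m)) = harm K"
    unfolding harm_def by (rule sum.reindex_bij_witness[of _ "\<lambda>i. K + 1 - i" "\<lambda>i. K + 1 - i"]) (auto simp: of_nat_diff)
  have gauss: "(\<Sum>m=1..K. real m) = real K * (real K + 1) / 2"
    by (induction K) (auto simp: field_simps)
  have "(\<Sum>m=1..Suc K. (x - (real m)\<^sup>2) * (harm (Suc K + m) - harm (Suc K - m))) =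
      (\<Sum>m=1..K. (x - (real m)\<^sup>2) * (harm (Suc K + m) - harm (Suc K - m))) + y * harm (2 * K + 2)"
    by (simp add: y_def mult_2 harm_expand add.commute)
  also have "(\<Sum>m=1..K. (x - (real m)\<^sup>2) * (harm (Suc K + m) - harm (Suc K - m))) =
     (\<Sum>m=1..K. (x - (real m)\<^sup>2) * (harm (K + m) - harm (K - m)) +
        (y * inverse (real K + 1 + real m) - y * inverse (real K + 1 - real m) - 2 * real m))"
  proof (rule sum.cong[OF refl])
    fix m assume "m \<in> {1..K}"
    then have m: "1 \<le> m" "m \<le> K" by auto
    have a: "harm (Suc K + m) = harm (K + m) + inverse (real K + 1 + real m)"
      by (simp add: harm_Suc algebra_simps)
    have b: "harm (Suc K - m) = harm (K - m) + inverse (real K + 1 - real m)"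
      using m by (simp add: Suc_diff_le harm_Suc of_nat_diff algebra_simps)
    have nz: "real K + 1 + m \<noteq> 0" "real K + 1 - m \<noteq> 0" using m by linarith+
    have c: "(x - (real m)\<^sup>2) * inverse (real K + 1 + real m) = y * inverse (real K + 1 + real m) + (real K + 1 - m)"
      using nz by (simp add: y_def field_simps power2_eq_square)
    have e: "(x - (real m)\<^sup>2) * inverse (real K + 1 - real m) = y * inverse (real K + 1 - real m) + (real K + 1 + m)"
      using nz by (simp add: y_def field_simps power2_eq_square)
    show "(x - (real m)\<^sup>2) * (harm (Suc K + m) - harm (Suc K - m)) = (x - (real m)\<^sup>2) * (harm (K + m) - harm (K - m)) +
        (y * inverse (real K + 1 + real m) - y * inverse (real K + 1 - real m) - 2 * real m)"
      unfolding a b using c e by (simp add: algebra_simps)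
  qed
  also have "\<dots> = (\<Sum>m=1..K. (x - (real m)\<^sup>2) * (harm (K + m) - harm (K - m))) +
      (y * (harm (2 * K + 1) - harm (K + 1)) - y * harm K - real K * (real K + 1))"
    unfolding harm_split[symmetric] harm_rev[symmetric]
    by (simp only: sum.distrib sum_subtractf sum_distrib_left[symmetric] gauss)
  also note Suc.IH
  finally have step: "(\<Sum>m=1..Suc K. (x - (real m)\<^sup>2) * (harm (Suc K + m) - harm (Suc K - m))) =
    (2 * real K + 1) * (x - real K * (real K + 1) / 3) * (harm (2 * K) - harm K) - real K ^ 3 / 3 - (real K)\<^sup>2 / 6
     + (y * (harm (2 * K + 1) - harm (K + 1)) - y * harm K - real K * (real K + 1)) + y * harm (2 * K + 2)" .
  define L where "L = harm (2 * K) - (harm K :: real)"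
  have h: "harm (2 * K) = harm K + L" by (simp add: L_def)
  have h1: "harm (2 * K + 1) = harm K + L + 1 / (2 * real K + 1)"
    by (simp add: harm_Suc L_def inverse_eq_divide add.commute)
  have h2: "harm (2 * K + 2) = harm K + L + 1 / (2 * real K + 1) + 1 / (2 * real K + 2)"
    by (simp add: harm_Suc L_def inverse_eq_divide add.commute)
  have h3: "harm (K + 1) = harm K + 1 / (real K + 1)"
    by (simp add: harm_Suc inverse_eq_divide add.commute)
  \<comment> \<open>What remains is a rational identity in k, x and L; the terms in H, standing for
    \<open>harm K\<close>, cancel.\<close>
  have closed_step: "(2 * k + 1) * (x - k * (k + 1) / 3) * (H + L - H) - k ^ 3 / 3 - k\<^sup>2 / 6
     + ((x - (k + 1)\<^sup>2) * ((H + L + 1 / (2 * k + 1)) - (H + 1 / (k + 1))) - (x - (k + 1)\<^sup>2) * H - k * (k + 1))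
     + (x - (k + 1)\<^sup>2) * (H + L + 1 / (2 * k + 1) + 1 / (2 * k + 2)) =
    (2 * (k + 1) + 1) * (x - (k + 1) * (k + 1 + 1) / 3) * (H + L - H + 1 / (2 * k + 1) - 1 / (2 * k + 2))
     - (k + 1) ^ 3 / 3 - (k + 1)\<^sup>2 / 6" if "k \<ge> 0" for k L H :: real
  proof -
    define u v where "u = 1 / (2 * k + 1)" and "v = 1 / (2 * k + 2)"
    have u: "u * (2 * k + 1) = 1" and v: "v * (2 * k + 2) = 1" using that by (auto simp: u_def v_def)
    have w: "1 / (k + 1) = 2 * v" using that by (simp add: v_def divide_simps)
    define z M where "z = x - (k + 1)\<^sup>2" and "M = (2 * (k + 1) + 1) * (x - (k + 1) * (k + 1 + 1) / 3)"
    \<comment> \<open>\<open>M\<close> is 2z plus a multiple of 2k + 1, and z plus a multiple of 2k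
      + 2, so in \<open>M * u\<close> and \<open>M * v\<close> the reciprocals survive only with the
      factor \<open>z\<close>.\<close>
    have "M - 2 * z = (2 * k + 1) * (x - k * (k + 1) / 3)"
      by (simp add: z_def M_def algebra_simps power2_eq_square)
    then have "(M - 2 * z) * u = (u * (2 * k + 1)) * (x - k * (k + 1) / 3)" by simp
    then have Mu: "M * u = 2 * z * u + (x - k * (k + 1) / 3)" unfolding u by (simp add: algebra_simps)
    have "M - z = (2 * k + 2) * (x - (2 * k\<^sup>2 + 4 * k + 3) / 6)"
      by (simp add: z_def M_def algebra_simps power2_eq_square)
    then have "(M - z) * v = (v * (2 * k + 2)) * (x - (2 * k\<^sup>2 + 4 * k + 3) / 6)" by simp
    then have Mv: "M * v = z * v + (x - (2 * k\<^sup>2 + 4 * k + 3) / 6)" unfolding v by (simp add: algebra_simps)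
    have e: "M * (H + L - H + u - v) = M * L + (2 * z * u + (x - k * (k + 1) / 3)) - (z * v + (x - (2 * k\<^sup>2 + 4 * k + 3) / 6))"
      unfolding Mu[symmetric] Mv[symmetric] by (simp add: algebra_simps)
    have "M = 2 * z + (2 * k + 1) * (x - k * (k + 1) / 3)"
      by (simp add: z_def M_def algebra_simps power2_eq_square)
    then have MmulL: "M * L = 2 * z * L + (2 * k + 1) * (x - k * (k + 1) / 3) * L" by (simp add: distrib_right)
    show ?thesis
      unfolding w u_def[symmetric] v_def[symmetric] z_def[symmetric] M_def[symmetric] e MmulL
      by (simp add: algebra_simps power2_eq_square power3_eq_cube) (simp add: field_simps)
  qed
  have k: "real (Suc K) = real K + 1" by simp
  show ?case
    unfolding step harm_double_diff_Suc h h1 h2 h3 y_def k by (rule closed_step) simp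
qed

section \<open>Counting triples by their third coordinate\<close>

lemma finite_triples: "finite (triples d)"
proof (rule finite_subset)
  show "triples d \<subseteq> {..d} \<times> {..d} \<times> {..d}"
    by (auto simp: triples_def power2_eq_square intro: le_trans[OF le_square] le_trans[OF _ le_add2])
qed simp

text \<open>A triple determines d, so the sets \<open>triples d\<close> are disjoint and their union
  can be listed by m and q first. Every triple that occurs has m \<le> K and q \<le> K + m.\<close>

lemma sum_g_eq_sum_card:
  assumes K: "K\<^sup>2 \<le> N" "N < (K + 1)\<^sup>2"
  shows "(\<Sum>d=1..N. g d) = (\<Sum>m=1..K. \<Sum>q=1..K+m.
    card {r. 0 < r \<and> q < r + 2 * m \<and> r < q + 2 * m \<and> m\<^sup>2 + q * r \<le> N})"
proof -
  define C where "C m q = {r. 0 < r \<and> q < r + 2 * m \<and> r < q + 2 * m \<and> m\<^sup>2 + q * r \<le> N}" for m q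
  have fin: "finite (C m q)" for m q
    by (rule finite_subset[of _ "{..q + 2 * m}"]) (auto simp: C_def)
  have "(\<Sum>d=1..N. g d) = card (\<Union>d\<in>{1..N}. triples d)"
    unfolding g_eq_card_triples
    by (rule card_UN_disjoint[symmetric]) (auto simp: finite_triples, auto simp: triples_def)
  also have "(\<Union>d\<in>{1..N}. triples d) = (SIGMA m:{1..K}. SIGMA q:{1..K+m}. C m q)"
  proof (intro equalityI subsetI)
    fix t assume "t \<in> (\<Union>d\<in>{1..N}. triples d)"
    then obtain m q r where t: "t = (m, q, r)" and q0: "0 < q" and r0: "0 < r" and qr: "q < r + 2 * m"
      and rq: "r < q + 2 * m" and N: "m\<^sup>2 + q * r \<le> N"
      by (auto simp: triples_def)
    have "m\<^sup>2 < (K + 1)\<^sup>2" using N K by linarith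
    then have "m < K + 1" by (rule power2_less_imp_less) simp
    then have "m \<le> K" by simp
    moreover have "1 \<le> m" using qr rq by linarith
    \<comment> \<open>Otherwise q - m \<ge> K + 1, while q + 1 \<le> r + 2m yields (q - m)^2 \<le>
      m^2 + q r \<le> N < (K + 1)^2.\<close>
    moreover have "q \<le> K + m"
    proof (rule ccontr)
      assume "\<not> q \<le> K + m"
      then have q: "K + m + 1 \<le> q" by simp
      have "int q * (int q + 1) \<le> int q * (int r + 2 * int m)" using qr by (intro mult_left_mono) auto
      then have "(int q - int m)\<^sup>2 \<le> int (m\<^sup>2 + q * r)"
        by (simp add: power2_eq_square algebra_simps)
      moreover have "(int (K + 1))\<^sup>2 \<le> (int q - int m)\<^sup>2" using q by (intro power_mono) auto
      moreover have "int (m\<^sup>2 + q * r) < (int (K + 1))\<^sup>2"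
        unfolding of_nat_power[symmetric] using N K(2) by (intro of_nat_less_iff[THEN iffD2]) linarith
      ultimately show False by linarith
    qed
    ultimately show "t \<in> (SIGMA m:{1..K}. SIGMA q:{1..K+m}. C m q)"
      using t q0 r0 qr rq N by (auto simp: C_def)
  next
    fix t assume "t \<in> (SIGMA m:{1..K}. SIGMA q:{1..K+m}. C m q)"
    then show "t \<in> (\<Union>d\<in>{1..N}. triples d)" by (auto simp: C_def triples_def Suc_le_eq)
  qed
  also have "card \<dots> = (\<Sum>m=1..K. \<Sum>q=1..K+m. card (C m q))"
    by (subst card_SigmaI) (auto simp: fin intro!: sum.cong card_SigmaI finite_SigmaI)
  finally show ?thesis by (simp add: C_def)
qed

text \<open>Here the bound by N is automatic, since r < q + 2m gives m^2 + q r \<le> (q + m)^2 \<le>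
  K^2. The truncation in \<open>q - 2 * m\<close> accounts for 0 < r.\<close>

lemma card_third_small:
  fixes K N m q :: nat
  assumes "K\<^sup>2 \<le> N" "q + m \<le> K"
  shows "card {r. 0 < r \<and> q < r + 2 * m \<and> r < q + 2 * m \<and> m\<^sup>2 + q * r \<le> N} = (q + 2 * m - 1) - (q - 2 * m)"
proof -
  have "m\<^sup>2 + q * r \<le> N" if "r < q + 2 * m" for r
  proof -
    have "q * r \<le> q * (q + 2 * m)" using that by (intro mult_left_mono) auto
    then have "m\<^sup>2 + q * r \<le> (q + m)\<^sup>2" by (simp add: power2_eq_square algebra_simps)
    also have "\<dots> \<le> K\<^sup>2" using assms(2) by (intro power_mono) auto
    finally show ?thesis using assms(1) by simp
  qed
  then have "{r. 0 < r \<and> q < r + 2 * m \<and> r < q + 2 * m \<and> m\<^sup>2 + q * r \<le> N} = {q - 2 * m + 1..q + 2 * m - 1}"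
    by auto
  then show ?thesis by simp
qed

text \<open>Here r < q + 2m is automatic instead, since r \<ge> q + 2m would force (q + m)^2 \<le>
  N. The second claim makes the outer subtraction in the first one exact.\<close>

lemma card_third_large:
  fixes K N m q :: nat
  assumes K: "K\<^sup>2 \<le> N" "N < (K + 1)\<^sup>2" and q: "K < q + m" "q \<le> K + m" "0 < q" and m: "m \<le> K"
  shows "card {r. 0 < r \<and> q < r + 2 * m \<and> r < q + 2 * m \<and> m\<^sup>2 + q * r \<le> N} = (N - m\<^sup>2) div q - (q - 2 * m)"
    and "q - 2 * m \<le> (N - m\<^sup>2) div q"
proof -
  have mN: "m\<^sup>2 \<le> N" using m K(1) by (meson le_trans power2_nat_le_eq_le)
  have le_iff: "m\<^sup>2 + q * r \<le> N \<longleftrightarrow> r \<le> (N - m\<^sup>2) div q" for r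
    using q mN by (simp add: less_eq_div_iff_mult_less_eq le_diff_conv2 mult.commute add.commute)
  have lt: "r < q + 2 * m" if "m\<^sup>2 + q * r \<le> N" for r
  proof (rule ccontr)
    assume "\<not> r < q + 2 * m"
    then have "q * (q + 2 * m) \<le> q * r" by (intro mult_left_mono) auto
    then have "(q + m)\<^sup>2 \<le> N" using that by (simp add: power2_eq_square algebra_simps)
    moreover have "(K + 1)\<^sup>2 \<le> (q + m)\<^sup>2" using q by (intro power_mono) auto
    ultimately show False using K(2) by linarith
  qed
  have "{r. 0 < r \<and> q < r + 2 * m \<and> r < q + 2 * m \<and> m\<^sup>2 + q * r \<le> N} = {q - 2 * m + 1..(N - m\<^sup>2) div q}"
    using lt unfolding le_iff by auto
  then show "card {r. 0 < r \<and> q < r + 2 * m \<and> r < q + 2 * m \<and> m\<^sup>2 + q * r \<le> N} = (N - m\<^sup>2) div q - (q - 2 * m)"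
    by simp
  have "q * (q - 2 * m) \<le> (K + m) * (K - m)" using q by (intro mult_mono) auto
  also have "\<dots> = K\<^sup>2 - m\<^sup>2" using m by (simp add: power2_eq_square algebra_simps diff_mult_distrib2)
  finally have "m\<^sup>2 + q * (q - 2 * m) \<le> N"
    using K(1) m power_mono[OF m, of 2] by linarith
  then show "q - 2 * m \<le> (N - m\<^sup>2) div q" by (simp add: le_iff)
qed

text \<open>Adding \<open>q - 2 * m\<close> to each count removes the truncated term in both ranges.
  Its total is the sum of all q \<le> K - m, which also appears in the short range, so the two
  cancel.\<close>

lemma sum_card_third:
  fixes K N m :: nat
  assumes K: "K\<^sup>2 \<le> N" "N < (K + 1)\<^sup>2" and m: "1 \<le> m" "m \<le> K"
  shows "(\<Sum>q=1..K+m. real (card {r. 0 < r \<and> q < r + 2 * m \<and> r < q + 2 * m \<and> m\<^sup>2 + q * r \<le> N})) =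
    (real K - real m) * (2 * real m - 1) + (\<Sum>q=K-m+1..K+m. real ((N - m\<^sup>2) div q))"
proof -
  define C where "C q = real (card {r. 0 < r \<and> q < r + 2 * m \<and> r < q + 2 * m \<and> m\<^sup>2 + q * r \<le> N})" for q
  have split: "{1..K+m} = {1..K-m} \<union> {K-m+1..K+m}" using m by auto
  have "(\<Sum>q=1..K+m. real (q - 2 * m)) = (\<Sum>q\<in>{1+2*m..(K-m)+2*m}. real (q - 2 * m))"
    by (rule sum.mono_neutral_right) (use m in auto)
  also have "\<dots> = (\<Sum>q=1..K-m. real q)"
    by (subst sum.shift_bounds_cl_nat_ivl) simp
  finally have excess: "(\<Sum>q=1..K+m. real (q - 2 * m)) = (\<Sum>q=1..K-m. real q)" .
  have "(\<Sum>q=1..K+m. C q) + (\<Sum>q=1..K+m. real (q - 2 * m)) = (\<Sum>q=1..K+m. C q + real (q - 2 * m))"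
    by (simp add: sum.distrib)
  also have "\<dots> = (\<Sum>q=1..K-m. C q + real (q - 2 * m)) + (\<Sum>q=K-m+1..K+m. C q + real (q - 2 * m))"
    unfolding split by (rule sum.union_disjoint) auto
  also have "(\<Sum>q=1..K-m. C q + real (q - 2 * m)) = (\<Sum>q=1..K-m. real q + (2 * real m - 1))"
  proof (rule sum.cong[OF refl])
    fix q assume "q \<in> {1..K-m}"
    then have "1 \<le> q" "q + m \<le> K" using m by auto
    with card_third_small[OF K(1), of q m] m show "C q + real (q - 2 * m) = real q + (2 * real m - 1)"
      by (simp add: C_def of_nat_diff)
  qed
  also have "(\<Sum>q=K-m+1..K+m. C q + real (q - 2 * m)) = (\<Sum>q=K-m+1..K+m. real ((N - m\<^sup>2) div q))"
  proof (rule sum.cong[OF refl])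
    fix q assume "q \<in> {K-m+1..K+m}"
    then have q: "K < q + m" "q \<le> K + m" "0 < q" by auto
    from card_third_large[OF K q m(2)] show "C q + real (q - 2 * m) = real ((N - m\<^sup>2) div q)"
      by (simp add: C_def of_nat_diff)
  qed
  also have "(\<Sum>q=1..K-m. real q + (2 * real m - 1)) = (\<Sum>q=1..K-m. real q) + (real K - real m) * (2 * real m - 1)"
    using m by (simp add: sum.distrib of_nat_diff)
  finally show ?thesis unfolding excess C_def by simp
qed

lemma sum_inverse_eq_harm_diff:
  assumes "m \<le> K"
  shows "(\<Sum>q=K-m+1..K+m. 1 / real q) = harm (K + m) - harm (K - m)"
proof -
  have "{1..K+m} = {1..K-m} \<union> {K-m+1..K+m}" using assms by auto
  then have "harm (K + m) = harm (K - m) + (\<Sum>q=K-m+1..K+m. inverse (real q))"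
    unfolding harm_def by (simp only:) (rule sum.union_disjoint, auto)
  then show ?thesis by (simp add: inverse_eq_divide)
qed

text \<open>\<open>U\<close> is the count with every floor replaced by the exact quotient. Each m
  has 2m quotients, each off by at most 1, and these add up to K (K + 1).\<close>

lemma sum_g_bounds:
  fixes x :: real
  assumes N: "real N \<le> x" "x < real N + 1" and K: "K\<^sup>2 \<le> N" "N < (K + 1)\<^sup>2"
  defines "U \<equiv> (2 * real K + 1) * (x - real K * (real K + 1) / 3) * (harm (2 * K) - harm K)
    - 2 * (real K)\<^sup>2 / 3 + real K / 6"
  shows "(\<Sum>d=1..N. real (g d)) \<le> U" "U - real K * (real K + 1) \<le> (\<Sum>d=1..N. real (g d))"
proof -
  define E where "E m = (\<Sum>q=K-m+1..K+m. real ((N - m\<^sup>2) div q))" for m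
  have E: "E m \<le> (x - (real m)\<^sup>2) * (harm (K + m) - harm (K - m))"
      "(x - (real m)\<^sup>2) * (harm (K + m) - harm (K - m)) - 2 * real m \<le> E m" if m: "m \<le> K" for m
  proof -
    have mN: "m\<^sup>2 \<le> N" using m K(1) by (meson le_trans power2_nat_le_eq_le)
    have eq: "(x - (real m)\<^sup>2) * (harm (K + m) - harm (K - m)) = (\<Sum>q=K-m+1..K+m. (x - (real m)\<^sup>2) / real q)"
      unfolding sum_inverse_eq_harm_diff[OF m, symmetric] by (simp add: sum_distrib_left)
    show "E m \<le> (x - (real m)\<^sup>2) * (harm (K + m) - harm (K - m))"
      unfolding eq E_def
    proof (rule sum_mono)
      fix q assume "q \<in> {K-m+1..K+m}"
      have "real ((N - m\<^sup>2) div q) \<le> real (N - m\<^sup>2) / real q" by (rule of_nat_div_le_of_nat)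
      also have "\<dots> \<le> (x - (real m)\<^sup>2) / real q" using N mN by (intro divide_right_mono) (auto simp: of_nat_diff)
      finally show "real ((N - m\<^sup>2) div q) \<le> (x - (real m)\<^sup>2) / real q" .
    qed
    have "(\<Sum>q=K-m+1..K+m. (x - (real m)\<^sup>2) / real q) \<le> (\<Sum>q=K-m+1..K+m. real ((N - m\<^sup>2) div q) + 1)"
    proof (rule sum_mono)
      fix q assume "q \<in> {K-m+1..K+m}"
      then have q: "0 < q" by auto
      have "N - m\<^sup>2 < ((N - m\<^sup>2) div q + 1) * q"
        using q by (metis Suc_eq_plus1 dividend_less_div_times add.commute mult_Suc)
      \<comment> \<open>Integrality gains a 1, which absorbs the excess of x over N.\<close>
      then have "N - m\<^sup>2 + 1 \<le> ((N - m\<^sup>2) div q + 1) * q" by simp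
      then have "real (N - m\<^sup>2 + 1) \<le> real (((N - m\<^sup>2) div q + 1) * q)" by (rule of_nat_mono)
      then have "real (N - m\<^sup>2) + 1 \<le> (real ((N - m\<^sup>2) div q) + 1) * real q" by (simp add: algebra_simps)
      then have "x - (real m)\<^sup>2 \<le> (real ((N - m\<^sup>2) div q) + 1) * real q" using N mN by (simp add: of_nat_diff)
      then show "(x - (real m)\<^sup>2) / real q \<le> real ((N - m\<^sup>2) div q) + 1" using q by (simp add: pos_divide_le_eq)
    qed
    also have "\<dots> = E m + 2 * real m" using m by (simp add: sum.distrib E_def of_nat_diff)
    finally show "(x - (real m)\<^sup>2) * (harm (K + m) - harm (K - m)) - 2 * real m \<le> E m" unfolding eq by simp
  qed
  have "(\<Sum>d=1..N. real (g d)) = (\<Sum>m=1..K. (real K - real m) * (2 * real m - 1) + E m)"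
    using sum_g_eq_sum_card[OF K] sum_card_third[OF K] unfolding of_nat_sum[symmetric]
    by (simp add: E_def)
  also have "\<dots> = (\<Sum>m=1..K. (real K - real m) * (2 * real m - 1)) + (\<Sum>m=1..K. E m)"
    by (rule sum.distrib)
  also have "(\<Sum>m=1..K. (real K - real m) * (2 * real m - 1)) = real K ^ 3 / 3 - (real K)\<^sup>2 / 2 + real K / 6"
  proof -
    \<comment> \<open>The factor K is generalised to \<open>y\<close>, so that the induction moves
      the upper limit alone.\<close>
    have "(\<Sum>m=1..n. (y - real m) * (2 * real m - 1)) = y * (real n)\<^sup>2 - 2 * real n ^ 3 / 3 - (real n)\<^sup>2 / 2 + real n / 6" for y n
      by (induction n) (auto simp: algebra_simps power2_eq_square power3_eq_cube add_divide_distrib)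
    then show ?thesis by (simp add: power2_eq_square power3_eq_cube)
  qed
  finally have sum: "(\<Sum>d=1..N. real (g d)) = real K ^ 3 / 3 - (real K)\<^sup>2 / 2 + real K / 6 + (\<Sum>m=1..K. E m)" .
  have "(\<Sum>m=1..K. E m) \<le> (\<Sum>m=1..K. (x - (real m)\<^sup>2) * (harm (K + m) - harm (K - m)))"
    using E by (intro sum_mono) auto
  then show "(\<Sum>d=1..N. real (g d)) \<le> U" unfolding sum U_def harm_window_sum by simp
  have "(\<Sum>m=1..K. (x - (real m)\<^sup>2) * (harm (K + m) - harm (K - m)) - 2 * real m) \<le> (\<Sum>m=1..K. E m)"
    using E by (intro sum_mono) auto
  moreover have "(\<Sum>m=1..K. 2 * real m) = real K * (real K + 1)"
    by (induction K) (auto simp: algebra_simps)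
  ultimately have "(\<Sum>m=1..K. (x - (real m)\<^sup>2) * (harm (K + m) - harm (K - m))) - real K * (real K + 1) \<le> (\<Sum>m=1..K. E m)"
    by (simp only: sum_subtractf)
  then show "U - real K * (real K + 1) \<le> (\<Sum>d=1..N. real (g d))"
    unfolding sum U_def harm_window_sum by simp
qed

section \<open>Estimating the main term\<close>

lemma main_term_estimate:
  fixes k X L :: real
  assumes k: "1 \<le> k" "k \<le> X" "X \<le> k + 1"
    and L: "ln 2 - 1 / (4 * k) \<le> L" "L \<le> ln 2 - 1 / (4 * k) + 1 / (16 * k\<^sup>2)"
  defines "U \<equiv> (2 * k + 1) * (X\<^sup>2 - k * (k + 1) / 3) * L - 2 * k\<^sup>2 / 3 + k / 6"
  shows "U \<le> 4 / 3 * ln 2 * X ^ 3 - X\<^sup>2 + 2 * X" "4 / 3 * ln 2 * X ^ 3 - X\<^sup>2 - X \<le> U"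
proof -
  \<comment> \<open>\<open>M\<close> is 4/3 X^3 up to an error \<open>D\<close> of linear size only,
    because X lies within 1/2 of the midpoint \<open>c\<close>. The correction M/(4k) to M ln 2 then
    produces the term -X^2.\<close>
  define c M D e where "c = k + 1 / 2" and "M = (2 * k + 1) * (X\<^sup>2 - k * (k + 1) / 3)"
    and "D = M - 4 / 3 * X ^ 3" and "e = X - k"
  have D: "D = - (2 / 3) * ((X - c)\<^sup>2 * (2 * X + c)) + c / 6"
    by (simp add: D_def M_def c_def algebra_simps power2_eq_square power3_eq_cube) (simp add: field_simps)
  have "\<bar>X - c\<bar> \<le> 1 / 2" unfolding c_def using k by linarith
  then have "\<bar>X - c\<bar>\<^sup>2 \<le> (1 / 2)\<^sup>2" by (intro power_mono) auto
  then have sq: "(X - c)\<^sup>2 \<le> 1 / 4" by (simp add: power2_eq_square)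
  have "(X - c)\<^sup>2 * (2 * X + c) \<le> 1 / 4 * (2 * X + c)" using sq k by (intro mult_right_mono) (auto simp: c_def)
  then have Dlo: "- X / 3 \<le> D" unfolding D by simp
  have "0 \<le> (X - c)\<^sup>2 * (2 * X + c)" using k by (simp add: c_def)
  then have Dhi: "D \<le> k / 4" unfolding D using k c_def by linarith
  have ln2: "0 \<le> ln (2::real)" "ln (2::real) \<le> 1" using ln_le_minus_one[of "2::real"] by auto
  have "k \<le> k\<^sup>2" using k by (simp add: power2_eq_square)
  moreover have "k\<^sup>2 \<le> X\<^sup>2" using k by (intro power_mono) auto
  moreover have "k * (k + 1) = k\<^sup>2 + k" by (simp add: power2_eq_square distrib_left)
  ultimately have "0 \<le> X\<^sup>2 - k * (k + 1) / 3" using k by linarith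
  then have M0: "0 \<le> M" using k by (simp add: M_def)
  have Mdiv: "M / (4 * k) = X ^ 3 / (3 * k) + D / (4 * k)" using k by (simp add: D_def field_simps)
  have Mln: "M * ln 2 = 4 / 3 * ln 2 * X ^ 3 + D * ln 2" by (simp add: D_def algebra_simps)
  \<comment> \<open>This expands (k + e)^3. The term 2k^2/3 will cancel the one in \<open>U\<close>;
    k e lies between 0 and k.\<close>
  have cube: "X ^ 3 / (3 * k) = X\<^sup>2 - 2 * k\<^sup>2 / 3 - k * e + e ^ 3 / (3 * k)"
  proof -
    have "X ^ 3 = (3 * k) * (X\<^sup>2 - 2 * k\<^sup>2 / 3 - k * e) + e ^ 3"
      by (simp add: e_def algebra_simps power2_eq_square power3_eq_cube)
    then show ?thesis using k by (simp add: add_divide_distrib)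
  qed
  have e: "0 \<le> e" "e \<le> 1" using k by (auto simp: e_def)
  have ke: "0 \<le> k * e" "k * e \<le> k" using k e by (auto simp: mult_left_le)
  have e0: "0 \<le> e ^ 3 / (3 * k)" using k e by simp
  have e1: "e ^ 3 / (3 * k) \<le> 1 / 3"
  proof -
    have "e ^ 3 \<le> k" using power_le_one[OF e, of 3] k by linarith
    then show ?thesis using k by (simp add: field_simps)
  qed
  have Dk_hi: "D / (4 * k) \<le> 1 / 16" using Dhi k by (simp add: field_simps)
  have "X * 1 \<le> X * k" using k by (intro mult_left_mono) auto
  then have "- (X * k) \<le> D * 3" using Dlo by linarith
  then have Dk_lo: "- X / 12 \<le> D / (4 * k)" using k by (simp add: field_simps)
  have Dln_hi: "D * ln 2 \<le> k / 4"
  proof -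
    have "D * ln 2 \<le> k / 4 * ln 2" using Dhi ln2 by (intro mult_right_mono) auto
    also have "\<dots> \<le> k / 4 * 1" using ln2 k by (intro mult_left_mono) auto
    finally show ?thesis by simp
  qed
  have Dln_lo: "- X / 3 \<le> D * ln 2"
  proof -
    have "- X / 3 = - X / 3 * 1" by simp
    also have "\<dots> \<le> - X / 3 * ln 2" using ln2 k by (intro mult_left_mono_neg) auto
    also have "\<dots> \<le> D * ln 2" using Dlo ln2 by (intro mult_right_mono) auto
    finally show ?thesis .
  qed
  \<comment> \<open>The term 1/(16 k^2) in the bound on \<open>L\<close> costs only a multiple of X,
    as X \<le> 2k.\<close>
  have Msmall: "M / (16 * k\<^sup>2) \<le> X / 2"
  proof -
    have "X * (X * X) \<le> X * ((2 * k) * (2 * k))" using k by (intro mult_left_mono mult_mono) auto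
    then have "X ^ 3 \<le> 4 * (X * k\<^sup>2)" by (simp add: power3_eq_cube power2_eq_square)
    moreover have "1 * k \<le> X * k\<^sup>2" using k by (intro mult_mono) (auto simp: power2_eq_square)
    ultimately have "M \<le> 8 * (X * k\<^sup>2)" using Dhi k unfolding D_def by linarith
    then show ?thesis using k by (simp add: field_simps)
  qed
  have U: "U = M * L - 2 * k\<^sup>2 / 3 + k / 6" by (simp add: U_def M_def)
  have "M * L \<le> M * (ln 2 - 1 / (4 * k) + 1 / (16 * k\<^sup>2))" using L M0 by (intro mult_left_mono) auto
  then have "M * L \<le> M * ln 2 - M / (4 * k) + M / (16 * k\<^sup>2)" by (simp add: algebra_simps)
  then show "U \<le> 4 / 3 * ln 2 * X ^ 3 - X\<^sup>2 + 2 * X"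
    using U Mln Mdiv cube e0 ke Dk_lo Dln_hi Msmall k by linarith
  have "M * (ln 2 - 1 / (4 * k)) \<le> M * L" using L M0 by (intro mult_left_mono) auto
  then have "M * ln 2 - M / (4 * k) \<le> M * L" by (simp add: algebra_simps)
  then show "4 / 3 * ln 2 * X ^ 3 - X\<^sup>2 - X \<le> U"
    using U Mln Mdiv cube e1 ke Dk_hi Dln_lo k by linarith
qed

text \<open>The upper bound is that of \<open>U\<close>; the lower one also pays K (K + 1) \<le> x +
  sqrt x for the floors. The two sides differ by x + 4 sqrt x, the range left to the error
  term.\<close>

lemma sum_g_asymp:
  fixes x :: real
  assumes N: "real N \<le> x" "x < real N + 1" and x: "1 \<le> x"
  shows "(\<Sum>d=1..N. real (g d)) \<le> 4 / 3 * ln 2 * sqrt x ^ 3 - x + 2 * sqrt x"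
    and "4 / 3 * ln 2 * sqrt x ^ 3 - 2 * x - 2 * sqrt x \<le> (\<Sum>d=1..N. real (g d))"
proof -
  define K where "K = nat \<lfloor>sqrt x\<rfloor>"
  have sx: "1 \<le> sqrt x" using x by simp
  have K: "real K \<le> sqrt x" "sqrt x < real K + 1" unfolding K_def using sx by linarith+
  have K1: "1 \<le> K" unfolding K_def using sx by linarith
  have "(real K)\<^sup>2 \<le> (sqrt x)\<^sup>2" using K by (intro power_mono) auto
  then have "real (K\<^sup>2) < real (N + 1)" using N x by simp
  then have KN: "K\<^sup>2 \<le> N" by linarith
  have "(sqrt x)\<^sup>2 < (real K + 1)\<^sup>2" using K x by (intro power_strict_mono) auto
  then have "x < (real K + 1)\<^sup>2" using x by simp
  then have "real N < real ((K + 1)\<^sup>2)" using N by (simp add: add.commute)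
  then have NK: "N < (K + 1)\<^sup>2" by (simp only: of_nat_less_iff)
  have k: "1 \<le> real K" "real K \<le> sqrt x" "sqrt x \<le> real K + 1" using K K1 by auto
  have x2: "(sqrt x)\<^sup>2 = x" using x by simp
  note est = main_term_estimate[OF k harm_double_diff_lower harm_double_diff_upper, unfolded x2]
  note bnd = sum_g_bounds[OF N KN NK]
  show "(\<Sum>d=1..N. real (g d)) \<le> 4 / 3 * ln 2 * sqrt x ^ 3 - x + 2 * sqrt x"
    using est(1) bnd(1) K1 by simp
  have "real K * (real K + 1) \<le> sqrt x * (sqrt x + 1)" using k x by (intro mult_mono) auto
  also have "\<dots> = x + sqrt x" using x by (simp add: distrib_left)
  finally show "4 / 3 * ln 2 * sqrt x ^ 3 - 2 * x - 2 * sqrt x \<le> (\<Sum>d=1..N. real (g d))"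
    using est(2) bnd(2) K1 by simp
qed

section \<open>The second moment\<close>

definition admissible :: "nat \<Rightarrow> (nat \<times> nat) set" where
  "admissible d = {(q, m). 0 < q \<and> m\<^sup>2 + q\<^sup>2 \<le> d \<and> d < (m + q)\<^sup>2}"

text \<open>The congruence expresses that q divides d - m^2; for fixed (q, m) it selects one class
  of d modulo q.\<close>

definition half_pairs :: "nat \<Rightarrow> (nat \<times> nat) set" where
  "half_pairs d = {(q, m) \<in> admissible d. d mod q = m\<^sup>2 mod q}"

definition square_pairs :: "nat \<Rightarrow> real" where
  "square_pairs e = (\<Sum>x<e. \<Sum>y<e. of_bool (x\<^sup>2 mod e = y\<^sup>2 mod e))"

lemma sum_of_bool_eq_card:
  "finite A \<Longrightarrow> (\<Sum>x\<in>A. of_bool (P x)) = real (card {x \<in> A. P x})"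
  by (simp add: Collect_conj_eq Int_commute)

text \<open>Comparing squares gives q, m \<le> s < m + q. The block \<open>{s + 1 - q..s}\<close>
  has exactly q elements, so it meets all classes modulo any divisor of q equally often.\<close>

lemma admissible_subset:
  assumes s: "s\<^sup>2 \<le> d" "d < (s + 1)\<^sup>2"
  shows "admissible d \<subseteq> (SIGMA q:{1..s}. {s + 1 - q..s})"
proof clarify
  fix q m assume "(q, m) \<in> admissible d"
  then have q: "0 < q" "m\<^sup>2 + q\<^sup>2 \<le> d" "d < (m + q)\<^sup>2" by (auto simp: admissible_def)
  have "m\<^sup>2 < (s + 1)\<^sup>2" "q\<^sup>2 < (s + 1)\<^sup>2" "s\<^sup>2 < (m + q)\<^sup>2" using q s by linarith+
  then have "m < s + 1" "q < s + 1" "s < m + q" by (auto dest: power2_less_imp_less)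
  then show "q \<in> {1..s} \<and> m \<in> {s + 1 - q..s}" using q by auto
qed

lemma finite_admissible: "finite (admissible d)"
proof (rule finite_subset)
  show "admissible d \<subseteq> {..d} \<times> {..d}"
    by (auto simp: admissible_def power2_eq_square intro: le_trans[OF le_square] le_trans[OF le_add1] le_trans[OF le_add2])
qed simp

lemma finite_half_pairs: "finite (half_pairs d)"
  by (rule finite_subset[OF _ finite_admissible]) (auto simp: half_pairs_def)

text \<open>Triples with q \<le> r are sent to (q, m) and those with r \<le> q to (r, m); both maps
  are injective, as d fixes the missing cofactor.\<close>

lemma g_le_half_pairs: "g d \<le> 2 * card (half_pairs d)"
proof -
  have mem: "(q, m) \<in> half_pairs (m\<^sup>2 + q * r)" if "0 < q" "q \<le> r" "r < q + 2 * m" for m q r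
  proof -
    have "q * q \<le> q * r" "q * r < q * (q + 2 * m)" using that by auto
    then show ?thesis using that
      by (auto simp: half_pairs_def admissible_def power2_eq_square algebra_simps)
  qed
  define A B where "A = {(m, q, r) \<in> triples d. q \<le> r}" and "B = {(m, q, r) \<in> triples d. r \<le> q}"
  have "card A \<le> card (half_pairs d)"
  proof (rule card_inj_on_le[OF _ _ finite_half_pairs])
    show "inj_on (\<lambda>(m, q, r). (q, m)) A" by (rule inj_onI) (auto simp: A_def triples_def)
    show "(\<lambda>(m, q, r). (q, m)) ` A \<subseteq> half_pairs d" using mem by (auto simp: A_def triples_def)
  qed
  moreover have "card B \<le> card (half_pairs d)"
  proof (rule card_inj_on_le[OF _ _ finite_half_pairs])
    show "inj_on (\<lambda>(m, q, r). (r, m)) B" by (rule inj_onI) (auto simp: B_def triples_def)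
    show "(\<lambda>(m, q, r). (r, m)) ` B \<subseteq> half_pairs d"
      using mem by (auto simp: B_def triples_def) (metis mult.commute)
  qed
  moreover have AB: "triples d = A \<union> B" by (auto simp: A_def B_def)
  ultimately show ?thesis unfolding g_eq_card_triples AB using card_Un_le[of A B] by linarith
qed

section \<open>Integers in residue classes\<close>

lemma card_residue_class_le:
  fixes L n a :: nat
  assumes D: "D \<subseteq> {a..<a + L * n}" and cong: "\<And>d d'. d \<in> D \<Longrightarrow> d' \<in> D \<Longrightarrow> d mod L = d' mod L"
  shows "card D \<le> n"
proof (cases "L = 0")
  case True then show ?thesis using D by auto
next
  case False
  \<comment> \<open>The interval is cut into n blocks of length L, and two members of one class in
    the same block coincide.\<close>
  have "card D \<le> card {..<n}"
  proof (rule card_inj_on_le[of "\<lambda>d. (d - a) div L"])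
    have *: "d = d'" if "d \<in> D" "d' \<in> D" "(d - a) div L = (d' - a) div L" "d \<le> d'" for d d'
    proof -
      have "L dvd d' - d" using cong[OF that(1,2)] that(4) by (metis mod_eq_dvd_iff_nat)
      moreover have "L * ((d' - a) div L) \<le> d - a" by (metis that(3) times_div_less_eq_dividend)
      moreover have "d' - a < L * ((d' - a) div L) + L"
        using dividend_less_times_div[of L "d' - a"] False by simp
      moreover have "a \<le> d" "a \<le> d'" using that D by auto
      ultimately have "d' - d < L" using that(4) by linarith
      with \<open>L dvd d' - d\<close> show ?thesis using that(4) by (auto dest: nat_dvd_not_less)
    qed
    show "inj_on (\<lambda>d. (d - a) div L) D"
    proof (rule inj_onI)
      fix d d' assume "d \<in> D" "d' \<in> D" "(d - a) div L = (d' - a) div L"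
      then show "d = d'" using *[of d d'] *[of d' d] by (cases "d \<le> d'") auto
    qed
    show "(\<lambda>d. (d - a) div L) ` D \<subseteq> {..<n}" using D False
      by (fastforce simp: div_less_iff_less_mult mult.commute)
  qed simp
  then show ?thesis by simp
qed

text \<open>The size conditions confine d to an interval, and the congruences to one class modulo
  the lcm or to none. The final 1 pays for an incomplete period.\<close>

lemma card_common_half_pairs:
  fixes q m q' m' N :: nat
  assumes q: "0 < q" "0 < q'"
  shows "real (card {d \<in> {1..N}. (q, m) \<in> half_pairs d \<and> (q', m') \<in> half_pairs d}) \<le>
     of_bool (m\<^sup>2 mod gcd q q' = m'\<^sup>2 mod gcd q q') / real (lcm q q') *
       card {d \<in> {1..N}. (q, m) \<in> admissible d \<and> (q', m') \<in> admissible d} + 1"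
proof -
  define D where "D = {d \<in> {1..N}. (q, m) \<in> half_pairs d \<and> (q', m') \<in> half_pairs d}"
  define a where "a = max 1 (max (m\<^sup>2 + q\<^sup>2) (m'\<^sup>2 + q'\<^sup>2))"
  define b where "b = min (N + 1) (min ((m + q)\<^sup>2) ((m' + q')\<^sup>2))"
  define L where "L = lcm q q'"
  have L: "L > 0" using q by (simp add: L_def lcm_pos_nat)
  have I: "{d \<in> {1..N}. (q, m) \<in> admissible d \<and> (q', m') \<in> admissible d} = {a..<b}"
    using q by (auto simp: admissible_def a_def b_def)
  show ?thesis
  proof (cases "D = {}")
    case True then show ?thesis unfolding D_def[symmetric] by simp
  next
    case False
    then obtain d where "d \<in> D" by auto
    then have d: "d mod q = m\<^sup>2 mod q" "d mod q' = m'\<^sup>2 mod q'" by (auto simp: D_def half_pairs_def)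
    \<comment> \<open>Both squares are congruent to d modulo the gcd, so the indicator is 1.\<close>
    have "m\<^sup>2 mod gcd q q' = m'\<^sup>2 mod gcd q q'"
      using d by (metis gcd_dvd1 gcd_dvd2 mod_mod_cancel)
    moreover have "card D \<le> (b - a) div L + 1"
    proof (rule card_residue_class_le)
      have "b - a < L * ((b - a) div L + 1)"
        using L by (metis Suc_eq_plus1 add.commute dividend_less_div_times mult.commute mult_Suc)
      moreover have "D \<subseteq> {a..<b}" unfolding I[symmetric] by (auto simp: D_def half_pairs_def)
      ultimately show "D \<subseteq> {a..<a + L * ((b - a) div L + 1)}" by fastforce
    next
      have *: "d mod L = d' mod L" if "d \<in> D" "d' \<in> D" "d' \<le> d" for d d'
      proof -
        have "d mod q = d' mod q" "d mod q' = d' mod q'" using that by (auto simp: D_def half_pairs_def)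
        then have "q dvd d - d'" "q' dvd d - d'" using that(3) by (simp_all add: mod_eq_dvd_iff_nat)
        then have "L dvd d - d'" by (simp add: L_def)
        then show ?thesis using that(3) by (simp add: mod_eq_dvd_iff_nat)
      qed
      show "d mod L = d' mod L" if "d \<in> D" "d' \<in> D" for d d'
        using *[of d d'] *[of d' d] that by (cases "d' \<le> d") auto
    qed
    moreover have "real ((b - a) div L) \<le> real (b - a) / real L" by (rule of_nat_div_le_of_nat)
    ultimately show ?thesis unfolding I D_def[symmetric] L_def[symmetric] by simp
  qed
qed

section \<open>Congruent squares\<close>

lemma sum_mod_period:
  fixes f :: "nat \<Rightarrow> real"
  shows "(\<Sum>m=u..<u + e. f (m mod e)) = (\<Sum>x<e. f x)"
proof (induction u)
  case 0 then show ?case by (simp add: atLeast0LessThan)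
next
  case (Suc u)
  show ?case
  proof (cases "e = 0")
    case False
    have "(\<Sum>m=u..<Suc u + e. f (m mod e)) = f (u mod e) + (\<Sum>m=Suc u..<Suc u + e. f (m mod e))"
      by (rule sum.atLeast_Suc_lessThan) simp
    moreover have "(\<Sum>m=u..<Suc u + e. f (m mod e)) = (\<Sum>m=u..<u + e. f (m mod e)) + f ((u + e) mod e)"
      by simp
    ultimately show ?thesis using Suc.IH by simp
  qed simp
qed

lemma sum_mod_periods:
  fixes f :: "nat \<Rightarrow> real"
  shows "(\<Sum>m=u..<u + e * a. f (m mod e)) = real a * (\<Sum>x<e. f x)"
proof (induction a)
  case (Suc a)
  have "(\<Sum>m=u..<u + e * Suc a. f (m mod e)) =
      (\<Sum>m=u..<u + e * a. f (m mod e)) + (\<Sum>m=u + e * a..<u + e * a + e. f (m mod e))"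
    by (subst sum.atLeastLessThan_concat) (auto simp: algebra_simps)
  then show ?case unfolding Suc.IH sum_mod_period by (simp add: algebra_simps)
qed simp

text \<open>The sides of the box are multiples of the period e, so each pair of residues is met a b
  times.\<close>

lemma sum_square_pairs_box:
  "(\<Sum>x=u..<u + e * a. \<Sum>y=v..<v + e * b. of_bool (x\<^sup>2 mod e = y\<^sup>2 mod e)) =
     real a * real b * square_pairs e"
proof -
  have inner: "(\<Sum>y=v..<v + e * b. of_bool (x\<^sup>2 mod e = y\<^sup>2 mod e)) =
      real b * (\<Sum>y<e. of_bool ((x mod e)\<^sup>2 mod e = y\<^sup>2 mod e))" for x
    using sum_mod_periods[of "\<lambda>y. of_bool (x\<^sup>2 mod e = y\<^sup>2 mod e)" e v b] by (simp add: power_mod)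
  show ?thesis unfolding inner square_pairs_def
    using sum_mod_periods[of "\<lambda>x. real b * (\<Sum>y<e. of_bool (x\<^sup>2 mod e = y\<^sup>2 mod e))" e u a]
    by (simp add: sum_distrib_left mult.assoc)
qed

text \<open>With x = u + y modulo e, the condition is that e divides u (u + 2y). For fixed u this
  has at most 2 gcd(u, e) solutions y, and in the sum of gcd(u, e) over u each divisor of e
  contributes at most e.\<close>

lemma square_pairs_le:
  assumes e: "e > 0"
  shows "square_pairs e \<le> 2 * real e * real (card {c. c dvd e})"
proof -
  have count: "card {y \<in> {..<e}. e dvd u * (u + 2 * y)} \<le> 2 * gcd u e" for u
  proof -
    define c f where "c = gcd u e" and "f = e div gcd u e"
    have ef: "e = c * f" by (simp add: c_def f_def)
    have c0: "c > 0" using e by (simp add: c_def)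
    obtain w where w: "u = c * w" unfolding c_def by (meson dvdE gcd_dvd1)
    have "coprime w f"
      using div_gcd_coprime[of u e] e w c0 unfolding c_def[symmetric] f_def by simp
    have dvd: "f dvd u + 2 * y" if "e dvd u * (u + 2 * y)" for y
    proof -
      have "c * f dvd c * (w * (u + 2 * y))" using that ef w by (simp add: mult.assoc)
      then have "f dvd w * (u + 2 * y)" using c0 by simp
      then show ?thesis using \<open>coprime w f\<close> by (simp add: coprime_commute coprime_dvd_mult_right_iff)
    qed
    define A where "A = {y \<in> {..<e}. e dvd u * (u + 2 * y)}"
    \<comment> \<open>Counting the values 2y below 2e, instead of y below e, avoids inverting 2
      modulo f, which may be even.\<close>
    have "card ((\<lambda>y. 2 * y) ` A) \<le> 2 * c"
    proof (rule card_residue_class_le)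
      show "(\<lambda>y. 2 * y) ` A \<subseteq> {0..<0 + f * (2 * c)}" by (auto simp: A_def ef mult.commute)
      have *: "2 * y mod f = 2 * y' mod f" if "y \<in> A" "y' \<in> A" "y' \<le> y" for y y'
      proof -
        have "f dvd (u + 2 * y) - (u + 2 * y')" using that dvd by (intro dvd_diff_nat) (auto simp: A_def)
        then show ?thesis using that(3) by (simp add: mod_eq_dvd_iff_nat)
      qed
      show "z mod f = z' mod f" if "z \<in> (\<lambda>y. 2 * y) ` A" "z' \<in> (\<lambda>y. 2 * y) ` A" for z z'
        using that * by (metis (no_types, lifting) imageE nat_le_linear)
    qed
    then show ?thesis by (simp add: card_image inj_on_def A_def c_def)
  qed
  have fin: "finite {c. c dvd e}" using e by simp
  have "square_pairs e = (\<Sum>y<e. \<Sum>x<e. of_bool (x\<^sup>2 mod e = y\<^sup>2 mod e))"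
    unfolding square_pairs_def by (rule sum.swap)
  also have "\<dots> = (\<Sum>y<e. \<Sum>u<e. of_bool (e dvd u * (u + 2 * y)))"
  proof (rule sum.cong[OF refl])
    fix y
    \<comment> \<open>By periodicity x may run through a full period starting at y.\<close>
    have "(\<Sum>x<e. of_bool (x\<^sup>2 mod e = y\<^sup>2 mod e)) = (\<Sum>x=0 + y..<e + y. of_bool ((x mod e)\<^sup>2 mod e = y\<^sup>2 mod e) :: real)"
      using sum_mod_period[of "\<lambda>x. of_bool (x\<^sup>2 mod e = y\<^sup>2 mod e)" e y] by (simp add: add.commute)
    also have "\<dots> = (\<Sum>u=0..<e. of_bool ((u + y)\<^sup>2 mod e = y\<^sup>2 mod e))"
      unfolding sum.shift_bounds_nat_ivl by (simp add: power_mod)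
    also have "\<dots> = (\<Sum>u<e. of_bool (e dvd u * (u + 2 * y)))"
    proof (rule sum.cong)
      fix u
      have "(u + y)\<^sup>2 - y\<^sup>2 = u * (u + 2 * y)" by (simp add: power2_eq_square algebra_simps)
      moreover have "y\<^sup>2 \<le> (u + y)\<^sup>2" by (intro power_mono) auto
      ultimately show "of_bool ((u + y)\<^sup>2 mod e = y\<^sup>2 mod e) = (of_bool (e dvd u * (u + 2 * y)) :: real)"
        by (simp add: mod_eq_dvd_iff_nat)
    qed auto
    finally show "(\<Sum>x<e. of_bool (x\<^sup>2 mod e = y\<^sup>2 mod e)) = (\<Sum>u<e. of_bool (e dvd u * (u + 2 * y)) :: real)" .
  qed
  also have "\<dots> = (\<Sum>u<e. \<Sum>y<e. of_bool (e dvd u * (u + 2 * y)))" by (rule sum.swap)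
  also have "\<dots> = (\<Sum>u<e. real (card {y \<in> {..<e}. e dvd u * (u + 2 * y)}))"
    by (simp only: sum_of_bool_eq_card finite_lessThan)
  also have "\<dots> \<le> (\<Sum>u<e. 2 * real (gcd u e))"
  proof (rule sum_mono)
    fix u
    show "real (card {y \<in> {..<e}. e dvd u * (u + 2 * y)}) \<le> 2 * real (gcd u e)"
      using of_nat_mono[OF count[of u], where ?'a = real] by simp
  qed
  \<comment> \<open>The gcd is one of the common divisors c, so the sum over all of them dominates
    it.\<close>
  also have "\<dots> \<le> (\<Sum>u<e. \<Sum>c | c dvd e. 2 * real c * of_bool (c dvd u))"
  proof (rule sum_mono)
    fix u
    show "2 * real (gcd u e) \<le> (\<Sum>c | c dvd e. 2 * real c * of_bool (c dvd u))"
      using member_le_sum[of "gcd u e" "{c. c dvd e}" "\<lambda>c. 2 * real c * of_bool (c dvd u)"] fin by simp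
  qed
  also have "\<dots> = (\<Sum>c | c dvd e. \<Sum>u<e. 2 * real c * of_bool (c dvd u))" by (rule sum.swap)
  also have "\<dots> \<le> (\<Sum>c | c dvd e. 2 * real e)"
  proof (rule sum_mono)
    fix c assume "c \<in> {c. c dvd e}"
    then have c: "c dvd e" by simp
    have "card {u \<in> {..<e}. c dvd u} \<le> e div c"
    proof (rule card_residue_class_le)
      show "{u \<in> {..<e}. c dvd u} \<subseteq> {0..<0 + c * (e div c)}" using c by auto
    qed auto
    then have "c * card {u \<in> {..<e}. c dvd u} \<le> c * (e div c)" by (rule mult_le_mono2)
    then have "real c * real (card {u \<in> {..<e}. c dvd u}) \<le> real e"
      by (simp only: of_nat_mult[symmetric] of_nat_le_iff dvd_mult_div_cancel[OF c])
    moreover have "(\<Sum>u<e. 2 * real c * of_bool (c dvd u)) = 2 * (real c * real (card {u \<in> {..<e}. c dvd u}))"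
      by (simp only: sum_distrib_left[symmetric] sum_of_bool_eq_card finite_lessThan mult.assoc)
    ultimately show "(\<Sum>u<e. 2 * real c * of_bool (c dvd u)) \<le> 2 * real e" by linarith
  qed
  also have "\<dots> = 2 * real e * real (card {c. c dvd e})" by simp
  finally show ?thesis .
qed

section \<open>Sums over divisors\<close>

lemma sum_inverse_squares_le: "(\<Sum>c=1..n. 1 / (real c)\<^sup>2) \<le> 7 / 4"
proof -
  \<comment> \<open>The constant is 1 + 1/4 + 1/2: beyond the second term, 1/c^2 \<le> 1/(c - 1) -
    1/c telescopes.\<close>
  have "(\<Sum>c=1..Suc (Suc n). 1 / (real c)\<^sup>2) \<le> 7 / 4 - 1 / (real n + 2)" for n
  proof (induction n)
    case 0 then show ?case by simp
  next
    case (Suc n)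
    have "1 / (real n + 3)\<^sup>2 \<le> 1 / ((real n + 2) * (real n + 3))"
      unfolding power2_eq_square by (intro divide_left_mono mult_right_mono) auto
    also have "\<dots> = 1 / (real n + 2) - 1 / (real n + 3)" by (simp add: field_simps)
    finally show ?case using Suc.IH by (simp add: add.commute)
  qed
  moreover have "0 \<le> 1 / (real k + 2)" for k by simp
  ultimately have "(\<Sum>c=1..Suc (Suc n). 1 / (real c)\<^sup>2) \<le> 7 / 4" for n by (smt (verit))
  moreover have "(\<Sum>c=1..n. 1 / (real c)\<^sup>2) \<le> (\<Sum>c=1..Suc (Suc n). 1 / (real c)\<^sup>2)"
    by (rule sum_mono2) auto
  ultimately show ?thesis by (meson order_trans)
qed

text \<open>Summing over the common divisor c last leaves the squared number of multiples of c up to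
  s, at most (s/c)^2.\<close>

lemma sum_card_common_divisors:
  "(\<Sum>q=1..s. \<Sum>q'=1..s. real (card {c. c dvd gcd q q'})) \<le> 7 / 4 * (real s)\<^sup>2"
proof -
  have card: "real (card {c. c dvd gcd q q'}) = (\<Sum>c=1..s. of_bool (c dvd q) * of_bool (c dvd q'))"
    if "q \<in> {1..s}" for q q' :: nat
  proof -
    have "{c. c dvd gcd q q'} = {c \<in> {1..s}. c dvd q \<and> c dvd q'}"
      using that by (auto dest: dvd_imp_le intro: Suc_leI dvd_pos_nat)
    then show ?thesis by (simp only: of_bool_conj[symmetric] sum_of_bool_eq_card finite_atLeastAtMost)
  qed
  have mult: "(\<Sum>q=1..s. of_bool (c dvd q)) \<le> real s / real c" if "c \<ge> 1" for c
  proof -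
    have "card {q \<in> {1..s}. c dvd q} \<le> card {1..s div c}"
    proof (rule card_inj_on_le[of "\<lambda>q. q div c"])
      show "inj_on (\<lambda>q. q div c) {q \<in> {1..s}. c dvd q}" using that by (auto simp: inj_on_def)
      show "(\<lambda>q. q div c) ` {q \<in> {1..s}. c dvd q} \<subseteq> {1..s div c}"
        using that by (auto elim!: dvdE simp: less_eq_div_iff_mult_less_eq mult.commute)
    qed simp
    then have "real (card {q \<in> {1..s}. c dvd q}) \<le> real (s div c)" by simp
    also have "\<dots> \<le> real s / real c" by (rule of_nat_div_le_of_nat)
    finally show ?thesis by (simp only: sum_of_bool_eq_card finite_atLeastAtMost)
  qed
  have "(\<Sum>q=1..s. \<Sum>q'=1..s. real (card {c. c dvd gcd q q'})) =
      (\<Sum>q=1..s. \<Sum>q'=1..s. \<Sum>c=1..s. of_bool (c dvd q) * of_bool (c dvd q'))"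
    by (intro sum.cong refl card) auto
  also have "\<dots> = (\<Sum>q=1..s. \<Sum>c=1..s. \<Sum>q'=1..s. of_bool (c dvd q) * of_bool (c dvd q'))"
    by (intro sum.cong refl sum.swap)
  also have "\<dots> = (\<Sum>c=1..s. \<Sum>q=1..s. \<Sum>q'=1..s. of_bool (c dvd q) * of_bool (c dvd q'))"
    by (rule sum.swap)
  also have "\<dots> = (\<Sum>c=1..s. (\<Sum>q=1..s. of_bool (c dvd q))\<^sup>2)"
    unfolding power2_eq_square sum_product ..
  also have "\<dots> \<le> (\<Sum>c=1..s. (real s / real c)\<^sup>2)"
    by (intro sum_mono power_mono mult sum_nonneg) auto
  also have "\<dots> = (real s)\<^sup>2 * (\<Sum>c=1..s. 1 / (real c)\<^sup>2)"
    by (simp add: sum_distrib_left power_divide)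
  also have "\<dots> \<le> (real s)\<^sup>2 * (7 / 4)" by (intro mult_left_mono sum_inverse_squares_le) auto
  finally show ?thesis by simp
qed

text \<open>By the Chinese remainder theorem, the density of the d congruent to m^2 modulo q and to
  m'^2 modulo q'.\<close>

definition weight :: "(nat \<times> nat) \<times> (nat \<times> nat) \<Rightarrow> real" where
  "weight = (\<lambda>((q, m), (q', m')). of_bool (m\<^sup>2 mod gcd q q' = m'\<^sup>2 mod gcd q q') / real (lcm q q'))"

text \<open>For q = e a and q' = e b with e = gcd q q', the two blocks contain a b
  \<open>square_pairs e\<close> compatible pairs, while the lcm is e a b. So a and b cancel, and
  twice the number of divisors of e bounds the rest.\<close>

lemma sum_weight_le:
  defines "S \<equiv> \<lambda>s. SIGMA q:{1..s}. {s + 1 - q..s}"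
  shows "(\<Sum>z\<in>S s \<times> S s. weight z) \<le> 7 / 2 * (real s)\<^sup>2"
proof -
  have Sigma: "(\<Sum>p\<in>S s. f p) = (\<Sum>q=1..s. \<Sum>m=s+1-q..s. f (q, m))" for f :: "nat \<times> nat \<Rightarrow> real"
    unfolding S_def by (subst sum.Sigma) auto
  have "(\<Sum>z\<in>S s \<times> S s. weight z) = (\<Sum>p\<in>S s. \<Sum>p'\<in>S s. weight (p, p'))"
    by (simp add: sum.cartesian_product)
  also have "\<dots> = (\<Sum>q=1..s. \<Sum>m=s+1-q..s. \<Sum>q'=1..s. \<Sum>m'=s+1-q'..s. weight ((q, m), (q', m')))"
    unfolding Sigma ..
  also have "\<dots> = (\<Sum>q=1..s. \<Sum>q'=1..s. \<Sum>m=s+1-q..s. \<Sum>m'=s+1-q'..s. weight ((q, m), (q', m')))"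
    by (intro sum.cong refl sum.swap)
  also have "\<dots> \<le> (\<Sum>q=1..s. \<Sum>q'=1..s. 2 * real (card {c. c dvd gcd q q'}))"
  proof (intro sum_mono)
    fix q q' assume "q \<in> {1..s}" "q' \<in> {1..s}"
    then have q: "0 < q" "q \<le> s" "0 < q'" "q' \<le> s" by auto
    define e where "e = gcd q q'"
    define a b where "a = q div e" and "b = q' div e"
    have e0: "e > 0" using q by (simp add: e_def)
    have ab: "q = e * a" "q' = e * b" by (auto simp: e_def a_def b_def)
    have ivl: "{s + 1 - q..s} = {s + 1 - q..<s + 1 - q + e * a}" "{s + 1 - q'..s} = {s + 1 - q'..<s + 1 - q' + e * b}"
      using q unfolding ab(1)[symmetric] ab(2)[symmetric] by auto
    have pos: "real e > 0" "real (lcm q q') > 0" using q e0 by (auto simp: lcm_pos_nat)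
    have "e * lcm q q' = q * q'" by (simp add: e_def prod_gcd_lcm_nat[symmetric])
    also have "\<dots> = e * (e * (a * b))" by (subst (1) ab(1), subst ab(2)) (simp add: ac_simps)
    finally have "lcm q q' = e * (a * b)" using e0 by simp
    then have lcm: "real (lcm q q') = real e * (real a * real b)" by simp
    have "(\<Sum>m=s+1-q..s. \<Sum>m'=s+1-q'..s. weight ((q, m), (q', m'))) =
        (\<Sum>m=s+1-q..s. \<Sum>m'=s+1-q'..s. of_bool (m\<^sup>2 mod e = m'\<^sup>2 mod e)) / real (lcm q q')"
      by (simp only: weight_def e_def sum_divide_distrib prod.case)
    also have "\<dots> = real a * real b * square_pairs e / real (lcm q q')"
      unfolding ivl sum_square_pairs_box ..
    also have "\<dots> = square_pairs e / real e"
      using pos(2) unfolding lcm by (auto simp: field_simps zero_less_mult_iff)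
    also have "\<dots> \<le> 2 * real (card {c. c dvd e})"
      using square_pairs_le[OF e0] pos by (simp add: field_simps)
    finally show "(\<Sum>m=s+1-q..s. \<Sum>m'=s+1-q'..s. weight ((q, m), (q', m'))) \<le> 2 * real (card {c. c dvd gcd q q'})"
      by (simp add: e_def)
  qed
  also have "\<dots> = 2 * (\<Sum>q=1..s. \<Sum>q'=1..s. real (card {c. c dvd gcd q q'}))"
    by (simp add: sum_distrib_left)
  also have "\<dots> \<le> 2 * (7 / 4 * (real s)\<^sup>2)" by (intro mult_left_mono sum_card_common_divisors) auto
  finally show ?thesis by simp
qed

section \<open>Assembling the second moment\<close>

lemma obtain_nat_sqrt:
  obtains s :: nat where "s\<^sup>2 \<le> d" "d < (s + 1)\<^sup>2"
proof -
  define s where "s = nat \<lfloor>sqrt (real d)\<rfloor>"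
  have s: "real s \<le> sqrt d" "sqrt d < real s + 1" unfolding s_def using real_sqrt_ge_zero[of "real d"] by linarith+
  have "(real s)\<^sup>2 \<le> (sqrt d)\<^sup>2" using s by (intro power_mono) auto
  then have "real (s\<^sup>2) \<le> real d" by simp
  moreover have "(sqrt d)\<^sup>2 < (real s + 1)\<^sup>2" using s by (intro power_strict_mono) auto
  then have "real d < real ((s + 1)\<^sup>2)" by (simp add: add.commute)
  ultimately have "s\<^sup>2 \<le> d" "d < (s + 1)\<^sup>2" by linarith+
  then show ?thesis by (rule that)
qed

text \<open>Each square is expanded into pairs of pairs. Summing over d first exploits the class
  modulo the lcm; restoring the order then lets m run through whole blocks for fixed d.\<close>

lemma sum_card_half_pairs_square:
  "(\<Sum>d=1..N. (real (card (half_pairs d)))\<^sup>2) \<le> 7 / 4 * real N * (real N + 1) + (real N)\<^sup>2"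
proof -
  obtain K where K: "K\<^sup>2 \<le> N" "N < (K + 1)\<^sup>2" by (rule obtain_nat_sqrt)
  define B where "B = {1..K} \<times> {1..K}"
  have finB: "finite B" by (simp add: B_def)
  have B: "admissible d \<subseteq> B" if "d \<le> N" for d
  proof -
    obtain s where s: "s\<^sup>2 \<le> d" "d < (s + 1)\<^sup>2" by (rule obtain_nat_sqrt)
    have "s\<^sup>2 < (K + 1)\<^sup>2" using s that K by linarith
    then have "s < K + 1" by (rule power2_less_imp_less) simp
    then show ?thesis using admissible_subset[OF s] by (fastforce simp: B_def)
  qed
  define H A where "H d z \<longleftrightarrow> fst z \<in> half_pairs d \<and> snd z \<in> half_pairs d"
    and "A d z \<longleftrightarrow> fst z \<in> admissible d \<and> snd z \<in> admissible d" for d z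
  have w0: "0 \<le> weight z" for z by (auto simp: weight_def split: prod.splits)
  have "(\<Sum>d=1..N. (real (card (half_pairs d)))\<^sup>2) = (\<Sum>d=1..N. \<Sum>z\<in>B \<times> B. of_bool (H d z))"
  proof (rule sum.cong[OF refl])
    fix d assume "d \<in> {1..N}"
    then have "half_pairs d \<subseteq> B" using B[of d] by (auto simp: half_pairs_def)
    then have "half_pairs d \<times> half_pairs d = {z \<in> B \<times> B. H d z}" by (auto simp: H_def)
    then have "card (half_pairs d) * card (half_pairs d) = card {z \<in> B \<times> B. H d z}"
      unfolding card_cartesian_product[symmetric] by simp
    moreover have "(\<Sum>z\<in>B \<times> B. of_bool (H d z)) = real (card {z \<in> B \<times> B. H d z})"
      using finB by (intro sum_of_bool_eq_card) simp
    ultimately show "(real (card (half_pairs d)))\<^sup>2 = (\<Sum>z\<in>B \<times> B. of_bool (H d z))"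
      by (simp only: power2_eq_square of_nat_mult[symmetric])
  qed
  also have "\<dots> = (\<Sum>z\<in>B \<times> B. \<Sum>d=1..N. of_bool (H d z))" by (rule sum.swap)
  also have "\<dots> = (\<Sum>z\<in>B \<times> B. real (card {d \<in> {1..N}. H d z}))"
    by (simp only: sum_of_bool_eq_card finite_atLeastAtMost)
  also have "\<dots> \<le> (\<Sum>z\<in>B \<times> B. weight z * real (card {d \<in> {1..N}. A d z}) + 1)"
  proof (rule sum_mono)
    fix z assume "z \<in> B \<times> B"
    then obtain q m q' m' where "z = ((q, m), (q', m'))" "0 < q" "0 < q'" by (auto simp: B_def)
    then show "real (card {d \<in> {1..N}. H d z}) \<le> weight z * real (card {d \<in> {1..N}. A d z}) + 1"
      using card_common_half_pairs[of q q' N m m'] by (simp add: H_def A_def weight_def)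
  qed
  \<comment> \<open>The error 1 occurs K^4 times, and K^4 \<le> N^2.\<close>
  also have "\<dots> = (\<Sum>z\<in>B \<times> B. \<Sum>d=1..N. weight z * of_bool (A d z)) + (real K ^ 2)\<^sup>2"
    unfolding sum.distrib sum_distrib_left[symmetric] sum_of_bool_eq_card[OF finite_atLeastAtMost]
    by (simp add: B_def card_cartesian_product power2_eq_square)
  also have "(\<Sum>z\<in>B \<times> B. \<Sum>d=1..N. weight z * of_bool (A d z)) = (\<Sum>d=1..N. \<Sum>z\<in>B \<times> B. weight z * of_bool (A d z))"
    by (rule sum.swap)
  also have "\<dots> \<le> (\<Sum>d=1..N. 7 / 2 * real d)"
  proof (rule sum_mono)
    fix d :: nat
    obtain s where s: "s\<^sup>2 \<le> d" "d < (s + 1)\<^sup>2" by (rule obtain_nat_sqrt)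
    define S where "S = (SIGMA q:{1..s}. {s + 1 - q..s})"
    have "(\<Sum>z\<in>B \<times> B. weight z * of_bool (A d z)) = (\<Sum>z\<in>{z \<in> B \<times> B. A d z}. weight z)"
      using finB by (intro sum.mono_neutral_cong_right) auto
    \<comment> \<open>The weights are nonnegative, so the admissible pairs may be enlarged to full
      blocks.\<close>
    also have "\<dots> \<le> (\<Sum>z\<in>S \<times> S. weight z)"
      using admissible_subset[OF s] w0
      by (intro sum_mono2) (auto simp: A_def S_def[symmetric], auto simp: S_def)
    also have "\<dots> \<le> 7 / 2 * (real s)\<^sup>2" unfolding S_def by (rule sum_weight_le)
    also have "(real s)\<^sup>2 \<le> real d" using s(1) by (metis of_nat_le_iff of_nat_power)
    finally show "(\<Sum>z\<in>B \<times> B. weight z * of_bool (A d z)) \<le> 7 / 2 * real d" by simp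
  qed
  also have "(\<Sum>d=1..N. 7 / 2 * real d) = 7 / 4 * real N * (real N + 1)"
    by (induction N) (auto simp: algebra_simps)
  also have "(real K ^ 2)\<^sup>2 \<le> (real N)\<^sup>2"
    using K(1) by (intro power_mono) (auto simp flip: of_nat_power)
  finally show ?thesis by simp
qed

text \<open>The constant 11 is 4 (7/4 + 1): 4 from the symmetry, 7/4 from the weights, 1 from the
  rounding errors.\<close>

lemma sum_g_square:
  "(\<Sum>d=1..N. (real (g d))\<^sup>2) \<le> 11 * (real N)\<^sup>2 + 7 * real N"
proof -
  have "(\<Sum>d=1..N. (real (g d))\<^sup>2) \<le> (\<Sum>d=1..N. 4 * (real (card (half_pairs d)))\<^sup>2)"
  proof (rule sum_mono)
    fix d
    have "real (g d) \<le> 2 * real (card (half_pairs d))"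
      using g_le_half_pairs[of d] by linarith
    then have "(real (g d))\<^sup>2 \<le> (2 * real (card (half_pairs d)))\<^sup>2" by (intro power_mono) auto
    then show "(real (g d))\<^sup>2 \<le> 4 * (real (card (half_pairs d)))\<^sup>2" by (simp add: power_mult_distrib)
  qed
  also have "\<dots> \<le> 4 * (7 / 4 * real N * (real N + 1) + (real N)\<^sup>2)"
    unfolding sum_distrib_left[symmetric] by (intro mult_left_mono sum_card_half_pairs_square) auto
  finally show ?thesis by (simp add: power2_eq_square distrib_left)
qed

section \<open>Both estimates in terms of x\<close>

theorem theorem1:
  fixes x :: real
  assumes "x > 1"
  shows "(\<exists>\<theta>\<in>{0..1}. (\<Sum>d | 1 \<le> d \<and> real d \<le> x. real (g d)) =
            c\<^sub>1 * x powr (3 / 2) - 2 * x - 2 * sqrt x + \<theta> * (x + 4 * sqrt x)) \<and>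
         (\<Sum>d | 1 \<le> d \<and> real d \<le> x. (real (g d))\<^sup>2) \<le>
            11.9 * x\<^sup>2 + 5 * x powr (3 / 2) * (ln (4 * exp 4 * x))\<^sup>2"
proof -
  define N where "N = nat \<lfloor>x\<rfloor>"
  have N: "real N \<le> x" "x < real N + 1" unfolding N_def using assms by linarith+
  have set: "{d. 1 \<le> d \<and> real d \<le> x} = {1..N}" using N by auto
  have x1: "1 \<le> x" using assms by simp
  have "x powr (3 / 2) = (x powr (1 / 2)) powr 3" by (simp add: powr_powr)
  also have "\<dots> = sqrt x ^ 3" using assms by (simp add: powr_half_sqrt)
  finally have powr: "x powr (3 / 2) = sqrt x ^ 3" .
  define T where "T = (\<Sum>d=1..N. real (g d))"
  define \<theta> where "\<theta> = (T - (c\<^sub>1 * sqrt x ^ 3 - 2 * x - 2 * sqrt x)) / (x + 4 * sqrt x)"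
  have pos: "x + 4 * sqrt x > 0" using assms by (simp add: add_pos_pos)
  have "T \<le> c\<^sub>1 * sqrt x ^ 3 - x + 2 * sqrt x" "c\<^sub>1 * sqrt x ^ 3 - 2 * x - 2 * sqrt x \<le> T"
    using sum_g_asymp[OF N x1] by (simp_all add: T_def c\<^sub>1_def)
  then have "\<theta> \<in> {0..1}" using pos by (simp add: \<theta>_def)
  moreover have "T = c\<^sub>1 * sqrt x ^ 3 - 2 * x - 2 * sqrt x + \<theta> * (x + 4 * sqrt x)"
    using pos by (simp add: \<theta>_def)
  ultimately have first: "\<exists>\<theta>\<in>{0..1}. T = c\<^sub>1 * sqrt x ^ 3 - 2 * x - 2 * sqrt x + \<theta> * (x + 4 * sqrt x)" ..
  \<comment> \<open>The logarithm is at least 4, so the second term of the bound is at least 80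
    x^(3/2) and absorbs 7 N.\<close>
  have "ln (4 * exp 4 * x) = ln 4 + 4 + ln x" using assms by (simp add: ln_mult)
  moreover have "0 \<le> ln (4 :: real)" "0 \<le> ln x" using assms by simp_all
  ultimately have "4 \<le> ln (4 * exp 4 * x)" by linarith
  then have "4\<^sup>2 \<le> (ln (4 * exp 4 * x))\<^sup>2" by (intro power_mono) auto
  then have "sqrt x ^ 3 * 16 \<le> sqrt x ^ 3 * (ln (4 * exp 4 * x))\<^sup>2"
    using assms by (intro mult_left_mono) auto
  moreover have "x \<le> sqrt x ^ 3"
  proof -
    have "x * 1 \<le> x * sqrt x" using assms by (intro mult_left_mono) auto
    also have "\<dots> = sqrt x ^ 3" using assms by (simp add: power3_eq_cube)
    finally show ?thesis by simp
  qed
  moreover have "(real N)\<^sup>2 \<le> x\<^sup>2" using N by (intro power_mono) auto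
  moreover have "0 \<le> x\<^sup>2" by simp
  ultimately have "11 * (real N)\<^sup>2 + 7 * real N \<le> 119 / 10 * x\<^sup>2 + 5 * (sqrt x ^ 3 * (ln (4 * exp 4 * x))\<^sup>2)"
    using N(1) x1 by linarith
  then have "(\<Sum>d=1..N. (real (g d))\<^sup>2) \<le> 11.9 * x\<^sup>2 + 5 * sqrt x ^ 3 * (ln (4 * exp 4 * x))\<^sup>2"
    using sum_g_square[of N] by (simp add: mult.assoc)
  with first show ?thesis unfolding set powr T_def by blast
qed

end
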